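(* Let $G=(V,E,I,\varsigma,\omega,\sigma)$ be an oriented hypergraph with incidence dual $G^*$. Then $$x^{|E|}\,\chi(\mathbf{L}_G,x)=x^{|V|}\,\chi(\mathbf{L}_{G^*},x),$$ where $\chi(\mathbf{L},x)=\det(xI-\mathbf{L})$ is the (traditional) characteristic polynomial of the Laplacian.
   Context: An oriented hypergraph is a sextuple $G=(V,E,I,\varsigma,\omega,\sigma)$ with finite sets $V$ (vertices), $E$ (edges), $I$ (incidences) and functions $\varsigma:I\to V$ (port), $\omega:I\to E$ (attachment), $\sigma:I\to\{+1,-1\}$ (incidence signs). Several incidences may have the same port and attachment. The incidence dual of $G$ is $G^*=(E,V,I,\omega,\varsigma,\sigma)$. The incidence matrix $\mathbf{H}_G$ is the $V\times E$ matrix whose $(v,e)$-entry is the sum of $\sigma(i)$ over all $i\in I$ with $\varsigma(i)=v$, $\omega(i)=e$. The Laplacian is $\mathbf{L}_G=\mathbf{H}_G\mathbf{H}_G^{T}$; thus $\mathbf{L}_{G}$ is a $V\times V$ matrix and the dual Laplacian $\mathbf{L}_{G^*}$ (also written $\mathbf{L}_G^*$) is an $E\times E$ matrix. *)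

theory Defs
  imports "Jordan_Normal_Form.Char_Poly"
begin

record ('v, 'e, 'i) oriented_hypergraph =
  verts :: "'v set"
  edges :: "'e set"
  incs :: "'i set"
  port :: "'i \<Rightarrow> 'v"
  attach :: "'i \<Rightarrow> 'e"
  isign :: "'i \<Rightarrow> int"

text \<open>The functions of the record are total; only their values on the incidences matter.\<close>

locale oriented_hypergraph =
  fixes G :: "('v, 'e, 'i) oriented_hypergraph"
  assumes finite_verts: "finite (verts G)"
    and finite_edges: "finite (edges G)"
    and finite_incs: "finite (incs G)"
    and port_in_verts: "i \<in> incs G \<Longrightarrow> port G i \<in> verts G"
    and attach_in_edges: "i \<in> incs G \<Longrightarrow> attach G i \<in> edges G"
    and isign_pm1: "i \<in> incs G \<Longrightarrow> isign G i \<in> {1, -1}"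

definition incidence_dual ::
  "('v, 'e, 'i) oriented_hypergraph \<Rightarrow> ('e, 'v, 'i) oriented_hypergraph" where
  "incidence_dual G =
     \<lparr>verts = edges G, edges = verts G, incs = incs G,
      port = attach G, attach = port G, isign = isign G\<rparr>"

definition incidence_entry :: "('v, 'e, 'i) oriented_hypergraph \<Rightarrow> 'v \<Rightarrow> 'e \<Rightarrow> int" where
  "incidence_entry G v e = (\<Sum>i | i \<in> incs G \<and> port G i = v \<and> attach G i = e. isign G i)"

text \<open>Library matrices are indexed by initial segments of the natural numbers. A matrix
  indexed by vertices and edges is therefore written with respect to an enumeration \<open>vs\<close> of
  the vertices and an enumeration \<open>es\<close> of the edges (duplicate-free lists of all of them).\<close>

definition incidence_matrix ::
  "('v, 'e, 'i) oriented_hypergraph \<Rightarrow> 'v list \<Rightarrow> 'e list \<Rightarrow> int mat" where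
  "incidence_matrix G vs es =
     mat (length vs) (length es) (\<lambda>(k, l). incidence_entry G (vs ! k) (es ! l))"

text \<open>The enumeration \<open>vs\<close> orders the rows and columns of the Laplacian; \<open>es\<close> only orders the
  summands in the matrix product.\<close>

definition laplacian ::
  "('v, 'e, 'i) oriented_hypergraph \<Rightarrow> 'v list \<Rightarrow> 'e list \<Rightarrow> int mat" where
  "laplacian G vs es = incidence_matrix G vs es * transpose_mat (incidence_matrix G vs es)"

definition enumerates :: "'a list \<Rightarrow> 'a set \<Rightarrow> bool" where
  "enumerates xs A \<longleftrightarrow> distinct xs \<and> set xs = A"

lemma oriented_hypergraph_incidence_dual:
  assumes "oriented_hypergraph G"
  shows "oriented_hypergraph (incidence_dual G)"
  using assms by (auto simp: oriented_hypergraph_def incidence_dual_def)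

lemma laplacian_index:
  assumes "enumerates es (edges G)" and "k < length vs" and "l < length vs"
  shows "laplacian G vs es $$ (k, l) =
    (\<Sum>e\<in>edges G. incidence_entry G (vs ! k) e * incidence_entry G (vs ! l) e)"
proof -
  have "laplacian G vs es $$ (k, l) =
    (\<Sum>m<length es. incidence_entry G (vs ! k) (es ! m) * incidence_entry G (vs ! l) (es ! m))"
    using assms(2,3)
    by (auto simp: laplacian_def incidence_matrix_def scalar_prod_def atLeast0LessThan
        intro!: sum.cong)
  also have "\<dots> = (\<Sum>e\<in>edges G. incidence_entry G (vs ! k) e * incidence_entry G (vs ! l) e)"
    using assms(1)
    by (intro sum.reindex_bij_betw bij_betw_nth) (auto simp: enumerates_def)
  finally show ?thesis .
qed

end

theory Submission
  imports Defs
begin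

text \<open>Conjugating by the unipotent block matrix \<open>(1 A; 0 1)\<close> turns \<open>(0 0; B B A)\<close> into
  \<open>(A B 0; B 0)\<close>. Both are block triangular, so comparing their characteristic polynomials shows
  that those of \<open>A B\<close> and \<open>B A\<close> agree up to powers of \<open>x\<close>. The dual hypergraph has the
  transposed incidence matrix, so this applies with \<open>B = A\<^sup>T\<close>.\<close>

lemma char_poly_zero_mat: "char_poly (0\<^sub>m n n :: 'a :: comm_ring_1 mat) = [:0, 1:] ^ n"
proof -
  have "char_poly_matrix (0\<^sub>m n n :: 'a mat) = [:0, 1:] \<cdot>\<^sub>m 1\<^sub>m n"
    by (intro eq_matI) (auto simp: char_poly_matrix_def)
  then show ?thesis
    by (simp add: char_poly_def)
qed

text \<open>Subtracting from \<open>x\<close> times the identity keeps the upper right block zero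
  and leaves the characteristic matrices of \<open>A\<close> and \<open>D\<close> on the diagonal,
  so the determinant splits.\<close>

lemma char_poly_four_block_upper_right_zero:
  fixes A :: "'a :: idom mat"
  assumes A: "A \<in> carrier_mat n n" and C: "C \<in> carrier_mat m n" and D: "D \<in> carrier_mat m m"
  shows "char_poly (four_block_mat A (0\<^sub>m n m) C D) = char_poly A * char_poly D"
proof -
  have "char_poly_matrix (four_block_mat A (0\<^sub>m n m) C D) =
      four_block_mat (char_poly_matrix A) (0\<^sub>m n m) (map_mat (\<lambda>a. [:- a:]) C) (char_poly_matrix D)"
    using assms by (intro eq_matI) (auto simp: char_poly_matrix_def)
  then show ?thesis
    unfolding char_poly_def
    using assms by (simp add: det_four_block_mat_upper_right_zero[OF _ refl])
qed

lemma similar_four_block_mult_commute: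
  fixes A B :: "'a :: comm_ring_1 mat"
  assumes A: "A \<in> carrier_mat n m" and B: "B \<in> carrier_mat m n"
  shows "similar_mat (four_block_mat (A * B) (0\<^sub>m n m) B (0\<^sub>m m m))
    (four_block_mat (0\<^sub>m n n) (0\<^sub>m n m) B (B * A))"
proof -
  define P where "P = four_block_mat (1\<^sub>m n) A (0\<^sub>m m n) (1\<^sub>m m)"
  \<comment> \<open>Block shears compose by adding their corner blocks, so negating \<open>A\<close>
    inverts \<open>P\<close>.\<close>
  define Q where "Q = four_block_mat (1\<^sub>m n) (- A) (0\<^sub>m m n) (1\<^sub>m m)"
  note carr = A B mult_carrier_mat[OF A B] mult_carrier_mat[OF B A]
    mult_carrier_mat[OF A mult_carrier_mat[OF B A]] uminus_carrier_mat[OF A]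
  have AA: "A + - A = 0\<^sub>m n m" "- A + A = 0\<^sub>m n m" "- (0\<^sub>m m m :: 'a mat) = 0\<^sub>m m m"
    by (rule eq_matI, use A in auto)+
  have PQ: "P * Q = 1\<^sub>m (n + m)"
    unfolding P_def Q_def
    by (subst mult_four_block_mat[of _ n n _ m _ m _ _ n _ m]) (use carr AA in simp_all)
  have QP: "Q * P = 1\<^sub>m (n + m)"
    unfolding P_def Q_def
    by (subst mult_four_block_mat[of _ n n _ m _ m _ _ n _ m]) (use carr AA in simp_all)
  have "P * four_block_mat (0\<^sub>m n n) (0\<^sub>m n m) B (B * A) =
      four_block_mat (A * B) (A * (B * A)) B (B * A)"
    unfolding P_def
    by (subst mult_four_block_mat[of _ n n _ m _ m _ _ n _ m]) (use carr in simp_all)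
  \<comment> \<open>Multiplying by \<open>Q\<close> subtracts the first block column times
    \<open>A\<close> from the second. Once \<open>A * B * A\<close> is reassociated, both blocks of
    the second column cancel.\<close>
  also have "\<dots> * Q = four_block_mat (A * B) (0\<^sub>m n m) B (0\<^sub>m m m)"
    unfolding Q_def
    by (subst mult_four_block_mat[of _ n n _ m _ m _ _ n _ m])
      (use carr in \<open>simp_all add: assoc_mult_mat[OF A B A] uminus_l_inv_mat[OF carr(4)] uminus_l_inv_mat[OF carr(5)]\<close>)
  finally show ?thesis
    using PQ QP carr by (intro similar_matI[of _ _ P Q "n + m"]) (auto simp: P_def Q_def)
qed

lemma char_poly_mult_commute:
  fixes A B :: "'a :: idom mat"
  assumes A: "A \<in> carrier_mat n m" and B: "B \<in> carrier_mat m n"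
  shows "[:0, 1:] ^ m * char_poly (A * B) = [:0, 1:] ^ n * char_poly (B * A)"
proof -
  have "char_poly (A * B) * [:0, 1:] ^ m =
      char_poly (four_block_mat (A * B) (0\<^sub>m n m) B (0\<^sub>m m m))"
    \<comment> \<open>The power of \<open>x\<close> is read back as the characteristic polynomial of
      the zero diagonal block, here of size \<open>m\<close> and below of size
      \<open>n\<close>.\<close>
    unfolding char_poly_zero_mat[symmetric] using A B
    by (intro char_poly_four_block_upper_right_zero[symmetric]) auto
  also have "\<dots> = char_poly (four_block_mat (0\<^sub>m n n) (0\<^sub>m n m) B (B * A))"
    by (rule char_poly_similar[OF similar_four_block_mult_commute[OF assms]])
  also have "\<dots> = [:0, 1:] ^ n * char_poly (B * A)"
    unfolding char_poly_zero_mat[symmetric] using A B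
    by (intro char_poly_four_block_upper_right_zero) auto
  finally show ?thesis
    by (subst mult.commute)
qed

text \<open>Duality swaps port and attachment and keeps the signs, so entries at
  \<open>(e, v)\<close> and \<open>(v, e)\<close> sum over the same incidences.\<close>

lemma incidence_matrix_dual:
  "incidence_matrix (incidence_dual G) es vs = transpose_mat (incidence_matrix G vs es)"
  by (rule eq_matI)
    (auto simp: incidence_matrix_def incidence_entry_def incidence_dual_def conj_commute)

theorem theorem3p2p6:
  fixes G :: "('v, 'e, 'i) oriented_hypergraph" and vs :: "'v list" and es :: "'e list"
  assumes "oriented_hypergraph G"
    and "enumerates vs (verts G)"
    and "enumerates es (edges G)"
  shows "[:0, 1:] ^ card (edges G) * char_poly (laplacian G vs es) =
         [:0, 1:] ^ card (verts G) * char_poly (laplacian (incidence_dual G) es vs)"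
proof -
  \<comment> \<open>The matrix sizes are list lengths; distinctness of the enumerations makes them
    the exponents of the claim.\<close>
  have "card (verts G) = length vs" "card (edges G) = length es"
    using assms(2,3) distinct_card by (fastforce simp: enumerates_def)+
  moreover have H: "incidence_matrix G vs es \<in> carrier_mat (length vs) (length es)"
    by (simp add: incidence_matrix_def)
  ultimately show ?thesis
    using char_poly_mult_commute[OF H transpose_carrier_mat[THEN iffD2, OF H]]
    \<comment> \<open>With \<open>H\<close> the incidence matrix, the double transpose collapses, so
      the dual Laplacian is the transpose of \<open>H\<close> times \<open>H\<close>.\<close>
    by (simp only: laplacian_def incidence_matrix_dual transpose_transpose)
qed

end
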